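(* Let $\{X_n\}_{n\in\mathbb{N}}$ be a collection of random variables on a common probability space, and let $\cdot\perp\!\!\!\perp_X\cdot\mid\cdot$ be the ternary relation on $\mathcal{P}(\mathbb{N})$ induced by conditional independence in $\{X_n\}_{n\in\mathbb{N}}$. Suppose this relation satisfies (P5* ). Then, with respect to any undirected graph $\mathcal{G}$ with vertex set $\mathbb{N}$, $$(\mathbb{N},\perp\!\!\!\perp_X)\text{ satisfies (G* )}\;\Leftrightarrow\;(\mathbb{N},\perp\!\!\!\perp_X)\text{ satisfies (L* )}\;\Leftrightarrow\;(\mathbb{N},\perp\!\!\!\perp_X)\text{ satisfies (P* )}.$$
   Context: For $A\subseteq\mathbb{N}$ write $X_A=(X_a)_{a\in A}$. For $A,B,C\subseteq\mathbb{N}$, $A\perp\!\!\!\perp_X B\mid C$ means $X_A\perp\!\!\!\perp X_B\mid X_C$, i.e. $\mathbb{P}(E_1\mid\sigma(X_C))\,\mathbb{P}(E_2\mid\sigma(X_C))=\mathbb{P}(E_1\cap E_2\mid\sigma(X_C))$ almost surely for all $E_1\in\sigma(X_A)$, $E_2\in\sigma(X_B)$. (P5* ) for a ternary relation $\perp$ on $\mathcal{P}(V)$: for all (possibly infinite) $X,Y,Z\subseteq V$ and any partition $X=\bigcup_k X_k$ into finite subsets of $V$, if $X_k\perp Y\mid Z\cup\left(\bigcup_{j\neq k}X_j\right)$ for all $k$, then $X\perp Y\mid Z$. Undirected graphs have no loops and no multiple edges. $\mathrm{ne}(i)$ is the set of neighbors of $i$, $\mathrm{cl}(i)=\{i\}\cup\mathrm{ne}(i)$,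 $i\not\sim_{\mathcal{G}}j$ means non-adjacent. $S$ separates $A$ from $B$ if every path from a vertex of $A$ to a vertex of $B$ contains a vertex of $S$ (sets may be empty). Set-Markov properties of $(V,\perp)$ with respect to a graph $\mathcal{G}$ on $V$: - (P* ) for distinct $i,j\in V$, $i\not\sim_{\mathcal{G}}j$ implies $\{i\}\perp\{j\}\mid V\setminus\{i,j\}$. - (L* ) for each $i\in V$, $\{i\}\perp V\setminus\mathrm{cl}(i)\mid\mathrm{ne}(i)$. - (G* ) for each triple $(A,B,S)$ of pairwise disjoint subsets of $V$ with $S$ separating $A$ from $B$, $A\perp B\mid S$. *)

theory Defs
  imports "HOL-Probability.Probability" "HOL-Library.Disjoint_Sets"
begin

subsection \<open>Conditional independence of subfamilies\<close>

text \<open>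
  \<open>X a\<close> takes values in the measurable space \<open>N a\<close>; real random variables are the case
  \<open>N a = borel\<close>. The \<open>\<sigma>\<close>-algebra of the subfamily indexed by \<open>A\<close> is the pullback of the
  product \<open>\<sigma>\<close>-algebra along \<open>\<omega> \<mapsto> (X a \<omega>)\<^sub>a\<^sub>\<in>\<^sub>A\<close>; it is trivial for \<open>A = {}\<close>.
\<close>

definition sigma_subfamily ::
  "'w measure \<Rightarrow> ('i \<Rightarrow> 'b measure) \<Rightarrow> ('i \<Rightarrow> 'w \<Rightarrow> 'b) \<Rightarrow> 'i set \<Rightarrow> 'w measure" where
  "sigma_subfamily M N X A =
     vimage_algebra (space M) (\<lambda>\<omega>. \<lambda>a\<in>A. X a \<omega>) (PiM A N)"

definition cond_prob_given :: "'w measure \<Rightarrow> 'w measure \<Rightarrow> 'w set \<Rightarrow> 'w \<Rightarrow> real" where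
  "cond_prob_given M F E = real_cond_exp M F (indicator E)"

definition cond_indep_rv ::
  "'w measure \<Rightarrow> ('i \<Rightarrow> 'b measure) \<Rightarrow> ('i \<Rightarrow> 'w \<Rightarrow> 'b)
     \<Rightarrow> 'i set \<Rightarrow> 'i set \<Rightarrow> 'i set \<Rightarrow> bool" where
  "cond_indep_rv M N X A B C \<longleftrightarrow>
     (\<forall>E1 \<in> sets (sigma_subfamily M N X A). \<forall>E2 \<in> sets (sigma_subfamily M N X B).
        AE \<omega> in M.
          cond_prob_given M (sigma_subfamily M N X C) E1 \<omega> *
          cond_prob_given M (sigma_subfamily M N X C) E2 \<omega> =
          cond_prob_given M (sigma_subfamily M N X C) (E1 \<inter> E2) \<omega>)"

subsection \<open>Ternary relations on the power set of \<open>V\<close>\<close>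

text \<open>
  In all predicates below, \<open>R A B S\<close> reads ``\<open>A\<close> is independent of \<open>B\<close> given \<open>S\<close>''.
  The sets \<open>X\<close>, \<open>Y\<close>, \<open>Z\<close> in the next property are not assumed disjoint, and the
  partition \<open>P\<close> of \<open>X\<close> may have finitely or infinitely many blocks.
\<close>

definition P5_star :: "'v set \<Rightarrow> ('v set \<Rightarrow> 'v set \<Rightarrow> 'v set \<Rightarrow> bool) \<Rightarrow> bool" where
  "P5_star V R \<longleftrightarrow>
     (\<forall>X Y Z P. X \<subseteq> V \<longrightarrow> Y \<subseteq> V \<longrightarrow> Z \<subseteq> V \<longrightarrow>
        partition_on X P \<longrightarrow> (\<forall>B\<in>P. finite B) \<longrightarrow>
        (\<forall>B\<in>P. R B Y (Z \<union> \<Union>(P - {B}))) \<longrightarrow>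
        R X Y Z)"

subsection \<open>Undirected graphs\<close>

text \<open>
  A graph is given by its vertex set \<open>V\<close> and its set \<open>E\<close> of edges, an edge being the
  two-element set of its end points.
\<close>

definition undirected_graph :: "'v set \<Rightarrow> 'v set set \<Rightarrow> bool" where
  "undirected_graph V E \<longleftrightarrow> E \<subseteq> {{i, j} | i j. i \<in> V \<and> j \<in> V \<and> i \<noteq> j}"

definition adjacent :: "'v set set \<Rightarrow> 'v \<Rightarrow> 'v \<Rightarrow> bool" where
  "adjacent E i j \<longleftrightarrow> {i, j} \<in> E"

definition ne :: "'v set set \<Rightarrow> 'v \<Rightarrow> 'v set" where
  "ne E i = {j. adjacent E i j}"

definition cl :: "'v set set \<Rightarrow> 'v \<Rightarrow> 'v set" where
  "cl E i = insert i (ne E i)"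

definition is_path :: "'v set \<Rightarrow> 'v set set \<Rightarrow> 'v list \<Rightarrow> bool" where
  "is_path V E p \<longleftrightarrow> p \<noteq> [] \<and> set p \<subseteq> V \<and> distinct p \<and> successively (adjacent E) p"

definition separates ::
  "'v set \<Rightarrow> 'v set set \<Rightarrow> 'v set \<Rightarrow> 'v set \<Rightarrow> 'v set \<Rightarrow> bool" where
  "separates V E S A B \<longleftrightarrow>
     (\<forall>p. is_path V E p \<longrightarrow> hd p \<in> A \<longrightarrow> last p \<in> B \<longrightarrow> set p \<inter> S \<noteq> {})"

subsection \<open>Set-Markov properties\<close>

definition P_star ::
  "'v set \<Rightarrow> ('v set \<Rightarrow> 'v set \<Rightarrow> 'v set \<Rightarrow> bool) \<Rightarrow> 'v set set \<Rightarrow> bool" where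
  "P_star V R E \<longleftrightarrow>
     (\<forall>i\<in>V. \<forall>j\<in>V. i \<noteq> j \<longrightarrow> \<not> adjacent E i j \<longrightarrow> R {i} {j} (V - {i, j}))"

definition L_star ::
  "'v set \<Rightarrow> ('v set \<Rightarrow> 'v set \<Rightarrow> 'v set \<Rightarrow> bool) \<Rightarrow> 'v set set \<Rightarrow> bool" where
  "L_star V R E \<longleftrightarrow> (\<forall>i\<in>V. R {i} (V - cl E i) (ne E i))"

definition G_star ::
  "'v set \<Rightarrow> ('v set \<Rightarrow> 'v set \<Rightarrow> 'v set \<Rightarrow> bool) \<Rightarrow> 'v set set \<Rightarrow> bool" where
  "G_star V R E \<longleftrightarrow>
     (\<forall>A B S. A \<subseteq> V \<longrightarrow> B \<subseteq> V \<longrightarrow> S \<subseteq> V \<longrightarrow>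
        A \<inter> B = {} \<longrightarrow> A \<inter> S = {} \<longrightarrow> B \<inter> S = {} \<longrightarrow>
        separates V E S A B \<longrightarrow> R A B S)"

end

theory Submission
  imports Defs
begin

text \<open>
  Pairwise to global: if \<open>S\<close> separates \<open>A\<close> from \<open>B\<close>, let \<open>A'\<close> be the set of vertices reachable
  from \<open>A\<close> outside \<open>S\<close> and \<open>B'\<close> the remaining vertices outside \<open>S\<close>. No vertex of \<open>A'\<close> is
  adjacent to one of \<open>B'\<close>, so the pairwise property gives \<open>i \<bottom> j | V - {i, j}\<close> for all
  \<open>i \<in> A'\<close> and \<open>j \<in> B'\<close>. The intersection property, applied to the partition of \<open>B'\<close> into
  singletons and then to that of \<open>A'\<close>, yields \<open>A' \<bottom> B' | S\<close>, and hence \<open>A \<bottom> B | S\<close>.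
  Local to pairwise is weak union; for conditional independence the latter rests on
  \<open>P(E | \<G> \<squnion> \<H>) = P(E | \<H>)\<close> whenever \<open>E\<close> is independent of \<open>\<G>\<close> given \<open>\<H>\<close>.
\<close>

section \<open>Set-Markov properties of abstract ternary relations\<close>

lemma not_adjacent_self: "undirected_graph V E \<Longrightarrow> \<not> adjacent E i i"
  unfolding undirected_graph_def adjacent_def by auto

lemma ne_subset: "undirected_graph V E \<Longrightarrow> ne E i \<subseteq> V"
  unfolding undirected_graph_def adjacent_def ne_def by (auto simp: doubleton_eq_iff)

text \<open>The singletons partition \<open>X\<close> into finite blocks, and the blocks other than
  \<open>{x}\<close> have union \<open>X - {x}\<close>. This is the form in which the intersection
  property is applied, to sets of any cardinality.\<close>

lemma P5_star_singletons:
  assumes "P5_star V R" "X \<subseteq> V" "Y \<subseteq> V" "Z \<subseteq> V"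
    and "\<And>x. x \<in> X \<Longrightarrow> R {x} Y (Z \<union> (X - {x}))"
  shows "R X Y Z"
proof -
  let ?P = "(\<lambda>x. {x}) ` X"
  have "partition_on X ?P"
    by (auto simp: partition_on_def disjoint_def)
  moreover have "R B Y (Z \<union> \<Union>(?P - {B}))" if "B \<in> ?P" for B
  proof -
    from that obtain x where x: "x \<in> X" "B = {x}" by auto
    then have "\<Union>(?P - {B}) = X - {x}" by auto
    with x assms(5) show ?thesis by simp
  qed
  moreover have "\<forall>B\<in>?P. finite B" by auto
  ultimately show ?thesis
    using assms(1)[unfolded P5_star_def, rule_format, OF assms(2-4), of ?P] by blast
qed

text \<open>This is the union of those connected components of the graph induced on
  \<open>V - S\<close> that meet \<open>A\<close>.\<close>

definition reachable_avoiding :: "'v set \<Rightarrow> 'v set set \<Rightarrow> 'v set \<Rightarrow> 'v set \<Rightarrow> 'v set" where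
  "reachable_avoiding V E S A =
     {last p | p. is_path V E p \<and> hd p \<in> A \<and> set p \<inter> S = {}}"

lemma reachable_avoiding_subset: "reachable_avoiding V E S A \<subseteq> V - S"
  unfolding reachable_avoiding_def is_path_def using last_in_set by fastforce

lemma subset_reachable_avoiding:
  assumes "A \<subseteq> V" "A \<inter> S = {}"
  shows "A \<subseteq> reachable_avoiding V E S A"
proof
  fix a assume "a \<in> A"
  with assms show "a \<in> reachable_avoiding V E S A"
    unfolding reachable_avoiding_def is_path_def by (intro CollectI exI[of _ "[a]"]) auto
qed

text \<open>Paths have distinct vertices, so \<open>w\<close> can be appended to a path ending in
  \<open>v\<close> only when it is new. If the path already visits \<open>w\<close>, its initial
  segment up to \<open>w\<close> serves instead.\<close>

lemma reachable_avoiding_step: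
  assumes "v \<in> reachable_avoiding V E S A" "adjacent E v w" "w \<in> V - S"
  shows "w \<in> reachable_avoiding V E S A"
proof -
  from assms(1) obtain p where p: "is_path V E p" "hd p \<in> A" "set p \<inter> S = {}" "last p = v"
    unfolding reachable_avoiding_def by auto
  have "\<exists>q. is_path V E q \<and> hd q = hd p \<and> set q \<inter> S = {} \<and> last q = w"
  proof (cases "w \<in> set p")
    case True
    then obtain ys zs where split: "p = (ys @ [w]) @ zs"
      by (metis append.assoc append_Cons append_Nil split_list)
    with p have "is_path V E (ys @ [w])"
      unfolding is_path_def split by (auto simp: successively_append_iff)
    moreover have "hd (ys @ [w]) = hd p" by (simp add: split hd_append)
    ultimately show ?thesis using p split by (intro exI[of _ "ys @ [w]"]) auto
  next
    case False
    with p assms have "is_path V E (p @ [w])"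
      unfolding is_path_def by (auto simp: successively_append_iff)
    moreover have "hd (p @ [w]) = hd p" using p(1) by (simp add: is_path_def)
    ultimately show ?thesis using p assms(3) by (intro exI[of _ "p @ [w]"]) auto
  qed
  with p(2) show ?thesis unfolding reachable_avoiding_def by force
qed

lemma separates_reachable_avoiding:
  "separates V E S A B \<Longrightarrow> reachable_avoiding V E S A \<inter> B = {}"
  unfolding separates_def reachable_avoiding_def by blast

section \<open>The implications between the three Markov properties\<close>

lemma P_star_imp_G_star:
  assumes P5: "P5_star V R"
    and sym: "\<And>A B C. R A B C \<Longrightarrow> R B A C"
    and decomp: "\<And>A B B' C. R A B C \<Longrightarrow> B' \<subseteq> B \<Longrightarrow> R A B' C"
    and P: "P_star V R E"
  shows "G_star V R E"
  unfolding G_star_def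
proof (intro allI impI)
  fix A B S
  assume sub: "A \<subseteq> V" "B \<subseteq> V" "S \<subseteq> V"
    and disj: "A \<inter> B = {}" "A \<inter> S = {}" "B \<inter> S = {}" and sep: "separates V E S A B"
  define A' where "A' = reachable_avoiding V E S A"
  define B' where "B' = V - S - A'"
  have A': "A' \<subseteq> V - S" "A \<subseteq> A'" "A' \<inter> B = {}"
    unfolding A'_def using sub disj sep
    by (simp_all add: reachable_avoiding_subset subset_reachable_avoiding
        separates_reachable_avoiding)
  have B': "B \<subseteq> B'" using A' sub disj by (auto simp: B'_def)
  have pair: "R {j} {i} (V - {i, j})" if "i \<in> A'" "j \<in> B'" for i j
  proof -
    have "\<not> adjacent E i j"
      using that reachable_avoiding_step[of i V E S A j] by (auto simp: A'_def B'_def)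
    with that A' have "R {i} {j} (V - {i, j})"
      using P by (auto simp: P_star_def B'_def)
    then show ?thesis by (rule sym)
  qed
  have point: "R {i} B' (S \<union> (A' - {i}))" if i: "i \<in> A'" for i
  proof (rule sym, rule P5_star_singletons[OF P5])
    fix j assume j: "j \<in> B'"
    \<comment> \<open>Since \<open>V\<close> is the disjoint union of \<open>S\<close>,
      \<open>A'\<close> and \<open>B'\<close>, the conditioning set demanded by the intersection
      property is exactly that of the pairwise property.\<close>
    then have "S \<union> (A' - {i}) \<union> (B' - {j}) = V - {i, j}"
      using i A' sub by (auto simp: B'_def)
    then show "R {j} {i} (S \<union> (A' - {i}) \<union> (B' - {j}))" using pair[OF i j] by simp
  qed (use i A' sub in \<open>auto simp: B'_def\<close>)
  have "A' \<subseteq> V" "B' \<subseteq> V" using A' by (auto simp: B'_def)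
  then have "R A' B' S" using sub(3) point by (rule P5_star_singletons[OF P5])
  \<comment> \<open>Decomposition shrinks the second argument only, so the two sides are cut down
    one after the other, with a swap after each.\<close>
  then have "R B A' S" using B' by (rule sym[OF decomp])
  then show "R A B S" using A'(2) by (rule sym[OF decomp])
qed

text \<open>The neighbours of \<open>i\<close> separate it from the vertices outside
  \<open>cl E i\<close>: a path between them does not end at \<open>i\<close>, and its second vertex
  is a neighbour. The absence of loops keeps \<open>i\<close> out of the separator.\<close>

lemma G_star_imp_L_star:
  assumes graph: "undirected_graph V E" and G: "G_star V R E"
  shows "L_star V R E"
  unfolding L_star_def
proof
  fix i assume i: "i \<in> V"
  have "separates V E (ne E i) {i} (V - cl E i)"
    unfolding separates_def
  proof (intro allI impI)
    fix p assume p: "is_path V E p" "hd p \<in> {i}" "last p \<in> V - cl E i"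
    then obtain qs where qs: "p = i # qs" by (cases p) (auto simp: is_path_def)
    with p(3) obtain j rs where "qs = j # rs" by (cases qs) (auto simp: cl_def)
    with p(1) qs show "set p \<inter> ne E i \<noteq> {}" by (auto simp: is_path_def ne_def)
  qed
  moreover have "{i} \<inter> ne E i = {}"
    using not_adjacent_self[OF graph] by (auto simp: ne_def)
  moreover have "{i} \<inter> (V - cl E i) = {}" "(V - cl E i) \<inter> ne E i = {}"
    by (auto simp: cl_def)
  moreover have "{i} \<subseteq> V" "V - cl E i \<subseteq> V" "ne E i \<subseteq> V"
    using i ne_subset[OF graph] by auto
  ultimately show "R {i} (V - cl E i) (ne E i)"
    using G unfolding G_star_def by simp
qed

lemma L_star_imp_P_star:
  assumes graph: "undirected_graph V E"
    and decomp: "\<And>A B B' C. R A B C \<Longrightarrow> B' \<subseteq> B \<Longrightarrow> R A B' C"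
    and weak_union: "\<And>A B C D. R A B C \<Longrightarrow> D \<subseteq> B \<Longrightarrow> R A B (C \<union> D)"
    and L: "L_star V R E"
  shows "P_star V R E"
  unfolding P_star_def
proof (intro ballI impI)
  fix i j assume ij: "i \<in> V" "j \<in> V" "i \<noteq> j" "\<not> adjacent E i j"
  \<comment> \<open>Weak union adds to \<open>ne E i\<close> every vertex outside
    \<open>cl E i\<close> except \<open>j\<close>, which fills the conditioning set up to
    \<open>V - {i, j}\<close>. Decomposition then keeps only \<open>j\<close> on the right.\<close>
  have "R {i} (V - cl E i) (ne E i \<union> (V - cl E i - {j}))"
    using L ij(1) by (auto simp: L_star_def intro: weak_union)
  moreover have "ne E i \<union> (V - cl E i - {j}) = V - {i, j}"
    using ij ne_subset[OF graph, of i] not_adjacent_self[OF graph, of i]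
    by (auto simp: cl_def ne_def)
  ultimately have "R {i} (V - cl E i) (V - {i, j})" by simp
  moreover have "{j} \<subseteq> V - cl E i" using ij by (auto simp: cl_def ne_def)
  ultimately show "R {i} {j} (V - {i, j})" by (rule decomp)
qed

section \<open>Conditional independence of \<open>\<sigma>\<close>-algebras\<close>

lemma (in prob_space) sigma_finite_subalgebraI: "subalgebra M F \<Longrightarrow> sigma_finite_subalgebra M F"
  by (intro finite_measure_subalgebra_is_sigma_finite)
    (simp add: finite_measure_subalgebra_def finite_measure_subalgebra_axioms_def
      finite_measure_axioms)

lemma (in prob_space) integrable_indicator_event:
  "A \<in> events \<Longrightarrow> integrable M (indicator A :: 'a \<Rightarrow> real)"
  by (rule integrable_real_indicator) (auto simp: less_top[symmetric])

lemma (in prob_space) integrable_cond_prob_given: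
  assumes "subalgebra M F" "A \<in> sets M"
  shows "integrable M (cond_prob_given M F A)"
proof -
  interpret F: sigma_finite_subalgebra M F using assms(1) by (rule sigma_finite_subalgebraI)
  show ?thesis unfolding cond_prob_given_def
    using assms(2) by (intro F.real_cond_exp_int integrable_indicator_event)
qed

text \<open>Dynkin's argument: by additivity of the integral, agreement passes to countable disjoint
  unions and to complements. For complements the integrals over the whole space must agree, hence
  \<open>space M \<in> \<C>\<close>.\<close>

lemma set_integral_eq_of_Int_stable_generator:
  fixes f g :: "'a \<Rightarrow> real"
  assumes f: "integrable M f" and g: "integrable M g"
    and gen: "Int_stable \<C>" "\<C> \<subseteq> sets M" "space M \<in> \<C>"
    and eq: "\<And>A. A \<in> \<C> \<Longrightarrow> (LINT x:A|M. f x) = (LINT x:A|M. g x)"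
    and A: "A \<in> sigma_sets (space M) \<C>"
  shows "(LINT x:A|M. f x) = (LINT x:A|M. g x)"
proof -
  have sets: "B \<in> sets M" if "B \<in> sigma_sets (space M) \<C>" for B
    using that gen(2) sets.sigma_sets_subset by blast
  have int: "set_integrable M B h" if "B \<in> sets M" "integrable M h" for B and h :: "'a \<Rightarrow> real"
    using that unfolding set_integrable_def by (intro integrable_mult_indicator) auto
  have pow: "\<C> \<subseteq> Pow (space M)" using gen(2) sets.sets_into_space by blast
  show ?thesis using gen(1) pow A
  proof (induction rule: sigma_sets_induct_disjoint)
    case (basic B)
    then show ?case by (rule eq)
  next
    case empty
    then show ?case by (simp add: set_lebesgue_integral_def)
  next
    case (compl B)
    note B = sets[OF compl(1)]
    have split: "(LINT x:space M|M. h x) = (LINT x:B|M. h x) + (LINT x:space M - B|M. h x)"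
      if h: "integrable M h" for h :: "'a \<Rightarrow> real"
    proof -
      have "B \<union> (space M - B) = space M" using sets.sets_into_space[OF B] by auto
      then show ?thesis
        using set_integral_Un[of B "space M - B" M h] int[OF _ h] B by simp
    qed
    show ?case using split[OF f] split[OF g] eq[OF gen(3)] compl(2) by simp
  next
    case (union B)
    have B: "B i \<in> sets M" for i using union(2) sets by auto
    have disj: "B i \<inter> B j = {}" if "i \<noteq> j" for i j
      using union(1) that by (auto simp: disjoint_family_on_def)
    have "(LINT x:(\<Union>i. B i)|M. h x) = (\<Sum>i. LINT x:B i|M. h x)"
      if "integrable M h" for h :: "'a \<Rightarrow> real"
      using B disj that by (intro lebesgue_integral_countable_add int) auto
    then show ?case using f g union(3) by simp
  qed
qed

text \<open>\<open>K\<close> lies between \<open>H\<close> and the join of \<open>G\<close> and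
  \<open>H\<close>. The conditional probability of \<open>A\<close> given \<open>H\<close> is
  \<open>K\<close>-measurable, so by uniqueness of conditional expectations it suffices to compare
  integrals over sets of \<open>K\<close>. Dynkin's argument reduces these to the sets
  \<open>g \<inter> h\<close>.\<close>

lemma (in prob_space) cond_prob_given_join:
  assumes sub: "subalgebra M G" "subalgebra M H" "subalgebra M K"
    and HK: "sets H \<subseteq> sets K"
    and K: "sets K \<subseteq> sigma_sets (space M) {g \<inter> h | g h. g \<in> sets G \<and> h \<in> sets H}"
    and A: "A \<in> sets M"
    and indep: "\<And>g. g \<in> sets G \<Longrightarrow>
      AE \<omega> in M. cond_prob_given M H A \<omega> * cond_prob_given M H g \<omega> = cond_prob_given M H (A \<inter> g) \<omega>"
  shows "AE \<omega> in M. cond_prob_given M K A \<omega> = cond_prob_given M H A \<omega>"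
proof -
  interpret H: sigma_finite_subalgebra M H using sub(2) by (rule sigma_finite_subalgebraI)
  interpret K: sigma_finite_subalgebra M K using sub(3) by (rule sigma_finite_subalgebraI)
  let ?f = "cond_prob_given M H A" and ?C = "{g \<inter> h | g h. g \<in> sets G \<and> h \<in> sets H}"
  have in_M: "B \<in> sets M" if "B \<in> sets G \<or> B \<in> sets H" for B
    using that sub by (auto simp: subalgebra_def)
  have spaces: "space M \<in> sets G" "space M \<in> sets H"
    using sub sets.top by (metis subalgebra_def)+
  note int_ind = integrable_indicator_event
  have int_f: "integrable M ?f" using sub(2) A by (rule integrable_cond_prob_given)
  have f_H: "?f \<in> borel_measurable H" unfolding cond_prob_given_def by simp
  \<comment> \<open>Over \<open>h\<close>, the indicator of \<open>A \<inter> g\<close> integrates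
    like its conditional probability given \<open>H\<close>, which independence factors. As
    \<open>indicator h * ?f\<close> is \<open>H\<close>-measurable, the remaining factor for
    \<open>g\<close> may be replaced by \<open>indicator g\<close> under the integral.\<close>
  have gen: "(LINT \<omega>:g \<inter> h|M. indicator A \<omega>) = (LINT \<omega>:g \<inter> h|M. ?f \<omega>)"
    if gh: "g \<in> sets G" "h \<in> sets H" for g h
  proof -
    have M: "g \<in> sets M" "h \<in> sets M" using gh in_M by auto
    have "integrable M (\<lambda>\<omega>. indicator (g \<inter> h) \<omega> * ?f \<omega>)"
      using integrable_mult_indicator[OF _ int_f, of "g \<inter> h"] M by simp
    then have int: "integrable M (\<lambda>\<omega>. (indicator h \<omega> * ?f \<omega>) * indicator g \<omega>)"
      by (simp add: indicator_inter_arith mult_ac)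
    have "(LINT \<omega>:g \<inter> h|M. indicator A \<omega>) = (LINT \<omega>:h|M. indicator (A \<inter> g) \<omega> :: real)"
      by (simp add: set_lebesgue_integral_def indicator_inter_arith mult_ac)
    also have "\<dots> = (LINT \<omega>:h|M. cond_prob_given M H (A \<inter> g) \<omega>)"
      unfolding cond_prob_given_def
      by (rule H.real_cond_exp_intA) (use gh M A in \<open>auto intro!: int_ind\<close>)
    also have "\<dots> = (LINT \<omega>|M. (indicator h \<omega> * ?f \<omega>) * cond_prob_given M H g \<omega>)"
      unfolding set_lebesgue_integral_def
    proof (rule integral_cong_AE)
      show "AE \<omega> in M. indicator h \<omega> *\<^sub>R cond_prob_given M H (A \<inter> g) \<omega> =
          indicator h \<omega> * ?f \<omega> * cond_prob_given M H g \<omega>"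
        using indep[OF gh(1)] by eventually_elim (simp add: mult_ac)
    qed (use M in \<open>simp_all add: cond_prob_given_def\<close>)
    also have "\<dots> = (LINT \<omega>|M. (indicator h \<omega> * ?f \<omega>) * indicator g \<omega>)"
      unfolding cond_prob_given_def[of M H g]
      by (rule H.real_cond_exp_intg(2)) (use int f_H gh M in auto)
    also have "\<dots> = (LINT \<omega>:g \<inter> h|M. ?f \<omega>)"
      by (simp add: set_lebesgue_integral_def indicator_inter_arith mult_ac)
    finally show ?thesis .
  qed
  have "AE \<omega> in M. real_cond_exp M K (indicator A) \<omega> = ?f \<omega>"
  proof (rule K.real_cond_exp_charact)
    fix B assume B: "B \<in> sets K"
    show "(LINT \<omega>:B|M. indicator A \<omega>) = (LINT \<omega>:B|M. ?f \<omega>)"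
    proof (rule set_integral_eq_of_Int_stable_generator[where \<C> = ?C])
      show "Int_stable ?C"
      proof (rule Int_stableI)
        fix a b assume "a \<in> ?C" "b \<in> ?C"
        then obtain g h g' h' where
          "a = g \<inter> h" "b = g' \<inter> h'" "g \<in> sets G" "h \<in> sets H" "g' \<in> sets G" "h' \<in> sets H"
          by auto
        then have "a \<inter> b = (g \<inter> g') \<inter> (h \<inter> h')" "g \<inter> g' \<in> sets G" "h \<inter> h' \<in> sets H" by auto
        then show "a \<inter> b \<in> ?C" by blast
      qed
      show "?C \<subseteq> sets M" using in_M by auto
      show "space M \<in> ?C" using spaces by (intro CollectI exI[of _ "space M"]) auto
      show "B \<in> sigma_sets (space M) ?C" using B K by auto
    qed (use int_f int_ind A gen in auto)
  next
    show "?f \<in> borel_measurable K"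
      using f_H HK sub by (intro measurable_from_subalg[of K H]) (auto simp: subalgebra_def)
  qed (use int_ind[OF A] int_f in auto)
  then show ?thesis by (simp add: cond_prob_given_def[of M K])
qed

text \<open>Given \<open>K\<close>, the event \<open>A\<close> has the same conditional probability
  \<open>?f\<close> as given \<open>H\<close>, and \<open>A \<inter> B\<close> has
  \<open>?f * indicator B\<close>. Projecting both from \<open>K\<close> to the intermediate
  \<open>H'\<close>, for which \<open>?f\<close> is measurable, gives the product formula.\<close>

lemma (in prob_space) cond_indep_weak_union:
  assumes sub: "subalgebra M G" "subalgebra M H" "subalgebra M H'" "subalgebra M K"
    and nested: "sets H \<subseteq> sets H'" "sets H' \<subseteq> sets K" "sets G \<subseteq> sets K"
    and K: "sets K \<subseteq> sigma_sets (space M) {g \<inter> h | g h. g \<in> sets G \<and> h \<in> sets H}"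
    and A: "A \<in> sets M" and B: "B \<in> sets G"
    and indep: "\<And>g. g \<in> sets G \<Longrightarrow>
      AE \<omega> in M. cond_prob_given M H A \<omega> * cond_prob_given M H g \<omega> = cond_prob_given M H (A \<inter> g) \<omega>"
  shows "AE \<omega> in M. cond_prob_given M H' A \<omega> * cond_prob_given M H' B \<omega> =
    cond_prob_given M H' (A \<inter> B) \<omega>"
proof -
  interpret H': sigma_finite_subalgebra M H' using sub(3) by (rule sigma_finite_subalgebraI)
  interpret K: sigma_finite_subalgebra M K using sub(4) by (rule sigma_finite_subalgebraI)
  let ?f = "cond_prob_given M H A"
  have join: "AE \<omega> in M. cond_prob_given M K A \<omega> = ?f \<omega>"
    by (rule cond_prob_given_join[OF sub(1,2,4) order_trans[OF nested(1,2)] K A indep])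
  have B_M: "B \<in> sets M" and B_K: "B \<in> sets K" using B nested sub by (auto simp: subalgebra_def)
  note int_ind = integrable_indicator_event
  have int_f: "integrable M ?f" using sub(2) A by (rule integrable_cond_prob_given)
  have int_fB: "integrable M (\<lambda>\<omega>. ?f \<omega> * indicator B \<omega>)"
    using integrable_mult_indicator[OF B_M int_f] by (simp add: mult_ac)
  have [measurable]: "?f \<in> borel_measurable M" using int_f by auto
  have f_H': "?f \<in> borel_measurable H'"
    by (rule measurable_from_subalg[of H' H])
      (use nested sub in \<open>auto simp: subalgebra_def cond_prob_given_def\<close>)
  have K_H': "subalgebra K H'" using nested sub by (simp add: subalgebra_def)
  have tower: "AE \<omega> in M. cond_prob_given M H' D \<omega> =
      real_cond_exp M H' (cond_prob_given M K D) \<omega>" if "D \<in> sets M" for D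
    using H'.real_cond_exp_nested_subalg[OF sub(4) K_H' int_ind[OF that]]
    by (simp add: cond_prob_given_def eq_commute)
  have "AE \<omega> in M. real_cond_exp M H' (cond_prob_given M K A) \<omega> = real_cond_exp M H' ?f \<omega>"
    using join by (rule H'.real_cond_exp_cong) (simp_all add: cond_prob_given_def)
  moreover have "AE \<omega> in M. real_cond_exp M H' ?f \<omega> = ?f \<omega>"
    using int_f f_H' by (rule H'.real_cond_exp_F_meas)
  ultimately have A_H': "AE \<omega> in M. cond_prob_given M H' A \<omega> = ?f \<omega>"
    using tower[OF A] by eventually_elim simp
  \<comment> \<open>\<open>B\<close> belongs to \<open>K\<close>, so its indicator can be taken out
    of the conditional expectation given \<open>K\<close>.\<close>
  have "AE \<omega> in M. cond_prob_given M K (A \<inter> B) \<omega> = indicator B \<omega> * cond_prob_given M K A \<omega>"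
  proof -
    have "indicator (A \<inter> B) = (\<lambda>\<omega>. indicator B \<omega> * indicator A \<omega> :: real)"
      by (auto simp: indicator_def)
    then show ?thesis
      unfolding cond_prob_given_def
      using K.real_cond_exp_mult[of "indicator B" "indicator A"] B_K A B_M int_ind[of "A \<inter> B"]
      by auto
  qed
  with join have "AE \<omega> in M. cond_prob_given M K (A \<inter> B) \<omega> = ?f \<omega> * indicator B \<omega>"
    by eventually_elim simp
  then have "AE \<omega> in M. real_cond_exp M H' (cond_prob_given M K (A \<inter> B)) \<omega> =
      real_cond_exp M H' (\<lambda>\<omega>. ?f \<omega> * indicator B \<omega>) \<omega>"
    by (rule H'.real_cond_exp_cong) (use B_M in \<open>simp_all add: cond_prob_given_def\<close>)
  moreover have "AE \<omega> in M. real_cond_exp M H' (\<lambda>\<omega>. ?f \<omega> * indicator B \<omega>) \<omega> =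
      ?f \<omega> * cond_prob_given M H' B \<omega>"
    unfolding cond_prob_given_def[of M H' B]
    by (rule H'.real_cond_exp_mult) (use f_H' B_M int_fB in auto)
  moreover have "A \<inter> B \<in> sets M" using A B_M by auto
  note tower[OF this]
  ultimately show ?thesis using A_H' by eventually_elim simp
qed

section \<open>Conditional independence of subfamilies\<close>

lemma space_sigma_subfamily [simp]: "space (sigma_subfamily M N X A) = space M"
  by (simp add: sigma_subfamily_def)

text \<open>Minimality: if \<open>L\<close> makes every \<open>X a\<close> measurable, it makes the
  joint map into the product measurable and so contains its pullback. Inclusions between these
  \<sigma>-algebras thereby reduce to measurability of single variables.\<close>

lemma sets_sigma_subfamily_subset:
  assumes "space L = space M" "\<And>a. a \<in> A \<Longrightarrow> X a \<in> measurable L (N a)"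
  shows "sets (sigma_subfamily M N X A) \<subseteq> sets L"
  unfolding sigma_subfamily_def
  using assms by (intro sets_image_in_sets measurable_restrict) auto

lemma measurable_sigma_subfamily:
  assumes "\<And>a. a \<in> A \<Longrightarrow> X a \<in> measurable M (N a)" "a \<in> A"
  shows "X a \<in> measurable (sigma_subfamily M N X A) (N a)"
proof -
  have "(\<lambda>\<omega>. \<lambda>a\<in>A. X a \<omega>) \<in> space M \<rightarrow> space (PiM A N)"
    by (auto simp: space_PiM intro: measurable_space[OF assms(1)])
  then have "(\<lambda>\<omega>. \<lambda>a\<in>A. X a \<omega>) \<in> measurable (sigma_subfamily M N X A) (PiM A N)"
    unfolding sigma_subfamily_def by (rule measurable_vimage_algebra1)
  from measurable_compose[OF this measurable_component_singleton[OF assms(2)]]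
  show ?thesis using assms(2) by simp
qed

context
  fixes M :: "'w measure" and N :: "'i \<Rightarrow> 'b measure" and X :: "'i \<Rightarrow> 'w \<Rightarrow> 'b"
  assumes X: "\<And>i. X i \<in> measurable M (N i)"
begin

lemma subalgebra_sigma_subfamily: "subalgebra M (sigma_subfamily M N X A)"
  unfolding subalgebra_def using X by (simp add: sets_sigma_subfamily_subset)

lemma sets_sigma_subfamily_mono:
  assumes "A \<subseteq> B"
  shows "sets (sigma_subfamily M N X A) \<subseteq> sets (sigma_subfamily M N X B)"
  using assms X by (intro sets_sigma_subfamily_subset measurable_sigma_subfamily) auto

text \<open>Taking one factor to be \<open>space M\<close> shows that the intersections include all
  events of both subfamilies. The \<sigma>-algebra they generate thus makes each \<open>X i\<close>
  with \<open>i \<in> A \<union> B\<close> measurable, and minimality applies.\<close>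

lemma sets_sigma_subfamily_Un:
  "sets (sigma_subfamily M N X (A \<union> B)) \<subseteq>
     sigma_sets (space M)
       {a \<inter> b | a b. a \<in> sets (sigma_subfamily M N X A) \<and> b \<in> sets (sigma_subfamily M N X B)}"
  (is "_ \<subseteq> sigma_sets _ ?C")
proof -
  have C: "?C \<subseteq> Pow (space M)"
    using sets.sets_into_space[of _ "sigma_subfamily M N X A"] by fastforce
  let ?L = "sigma (space M) ?C"
  have top: "space M \<in> sets (sigma_subfamily M N X D)" for D
    using sets.top[of "sigma_subfamily M N X D"] by simp
  have "a \<in> sets ?L" if a: "a \<in> sets (sigma_subfamily M N X A)" for a
  proof -
    have "a \<inter> space M = a" using sets.sets_into_space[OF a] by auto
    then have "a \<in> ?C" using a top by (intro CollectI exI[of _ a] exI[of _ "space M"]) auto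
    then show ?thesis using C by auto
  qed
  moreover have "b \<in> sets ?L" if b: "b \<in> sets (sigma_subfamily M N X B)" for b
  proof -
    have "space M \<inter> b = b" using sets.sets_into_space[OF b] by auto
    then have "b \<in> ?C" using b top by (intro CollectI exI[of _ "space M"] exI[of _ b]) auto
    then show ?thesis using C by auto
  qed
  ultimately have L: "subalgebra ?L (sigma_subfamily M N X A)"
      "subalgebra ?L (sigma_subfamily M N X B)"
    using C by (auto simp: subalgebra_def)
  have "sets (sigma_subfamily M N X (A \<union> B)) \<subseteq> sets ?L"
  proof (rule sets_sigma_subfamily_subset)
    fix i assume "i \<in> A \<union> B"
    then show "X i \<in> measurable ?L (N i)"
      using measurable_from_subalg[OF L(1)] measurable_from_subalg[OF L(2)]
        measurable_sigma_subfamily[of A X M N i] measurable_sigma_subfamily[of B X M N i] X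
      by auto
  qed (use C in simp)
  then show ?thesis using C by simp
qed

section \<open>Symmetry, decomposition and weak union\<close>

lemma cond_indep_rv_sym: "cond_indep_rv M N X A B C \<Longrightarrow> cond_indep_rv M N X B A C"
  unfolding cond_indep_rv_def
  by (intro ballI) (subst mult.commute, subst Int_commute, blast)

lemma cond_indep_rv_decomposition:
  "cond_indep_rv M N X A B C \<Longrightarrow> B' \<subseteq> B \<Longrightarrow> cond_indep_rv M N X A B' C"
  unfolding cond_indep_rv_def by (meson sets_sigma_subfamily_mono subsetD)

text \<open>As \<open>D \<subseteq> B\<close>, the \<sigma>-algebra of \<open>C \<union> D\<close>
  lies between those of \<open>C\<close> and \<open>B \<union> C\<close>, so weak union for
  \<sigma>-algebras applies. The second set remains \<open>B\<close>, overlapping the conditioning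
  set in \<open>D\<close>.\<close>

lemma cond_indep_rv_weak_union:
  assumes "prob_space M" "cond_indep_rv M N X A B C" "D \<subseteq> B"
  shows "cond_indep_rv M N X A B (C \<union> D)"
proof -
  interpret prob_space M by fact
  let ?\<sigma> = "sigma_subfamily M N X"
  show ?thesis
    unfolding cond_indep_rv_def
  proof (intro ballI)
    fix E1 E2 assume E: "E1 \<in> sets (?\<sigma> A)" "E2 \<in> sets (?\<sigma> B)"
    show "AE \<omega> in M. cond_prob_given M (?\<sigma> (C \<union> D)) E1 \<omega> * cond_prob_given M (?\<sigma> (C \<union> D)) E2 \<omega> =
        cond_prob_given M (?\<sigma> (C \<union> D)) (E1 \<inter> E2) \<omega>"
    proof (rule cond_indep_weak_union[where G = "?\<sigma> B" and H = "?\<sigma> C" and K = "?\<sigma> (B \<union> C)"])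
      show "E1 \<in> sets M" using E(1) subalgebra_sigma_subfamily by (auto simp: subalgebra_def)
      show "E2 \<in> sets (?\<sigma> B)" by (rule E(2))
      show "AE \<omega> in M. cond_prob_given M (?\<sigma> C) E1 \<omega> * cond_prob_given M (?\<sigma> C) g \<omega> =
          cond_prob_given M (?\<sigma> C) (E1 \<inter> g) \<omega>" if "g \<in> sets (?\<sigma> B)" for g
        using assms(2) E(1) that unfolding cond_indep_rv_def by blast
    qed (intro subalgebra_sigma_subfamily sets_sigma_subfamily_Un sets_sigma_subfamily_mono;
        use assms(3) in blast)+
  qed
qed

end

theorem corollary2p4:
  fixes M :: "'w measure" and N :: "nat \<Rightarrow> 'b measure" and X :: "nat \<Rightarrow> 'w \<Rightarrow> 'b"
    and E :: "nat set set"
  assumes "prob_space M"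
    and "\<And>n. X n \<in> measurable M (N n)"
    and "P5_star UNIV (cond_indep_rv M N X)"
    and "undirected_graph UNIV E"
  shows "(G_star UNIV (cond_indep_rv M N X) E \<longleftrightarrow> L_star UNIV (cond_indep_rv M N X) E) \<and>
         (L_star UNIV (cond_indep_rv M N X) E \<longleftrightarrow> P_star UNIV (cond_indep_rv M N X) E)"
proof -
  let ?R = "cond_indep_rv M N X"
  note sym = cond_indep_rv_sym[OF assms(2)]
    and decomp = cond_indep_rv_decomposition[OF assms(2)]
    and weak_union = cond_indep_rv_weak_union[OF assms(2,1)]
  \<comment> \<open>The equivalences are closed as a cycle from global to local to pairwise and back
    to global; the intersection property enters in the last implication.\<close>
  have "G_star UNIV ?R E \<Longrightarrow> L_star UNIV ?R E"
    using assms(4) by (rule G_star_imp_L_star)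
  moreover have "L_star UNIV ?R E \<Longrightarrow> P_star UNIV ?R E"
    using assms(4) decomp weak_union by (rule L_star_imp_P_star)
  moreover have "P_star UNIV ?R E \<Longrightarrow> G_star UNIV ?R E"
    using assms(3) sym decomp by (rule P_star_imp_G_star)
  ultimately show ?thesis by blast
qed

end
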